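(* Let $d=1$. For a topography $z_b:\mathbb{R}\to\mathbb{R}$ and functions $H,\tilde u$ on $\tilde\Omega=\mathbb{R}\times I$, the following properties are equivalent: (i) $(H,\tilde u)$ is a stationary solution (i.e. independent of $t$) of $$\partial_tH+\partial_x(H\tilde u)=0,\qquad \partial_t\tilde u+\tilde u\,\partial_x\tilde u+g\,\partial_x\int_0^1H\,\mathrm{d}\lambda=-g\,\partial_xz_b\qquad\text{in }\tilde\Omega,$$ with $H>0$ and $\tilde u>0$; (ii) there exist three functions $F:\bar I\to\mathbb{R}$, $G:\mathbb{R}\to\mathbb{R}$ and $Q:I\to\mathbb{R}$ with $F(\lambda)-G(x)>0$ for all $(x,\lambda)\in\tilde\Omega$, such that $$\tilde u(t,x,\lambda)=\sqrt{F(\lambda)-G(x)}>0,\qquad H(t,x,\lambda)=\frac{Q(\lambda)}{\sqrt{F(\lambda)-G(x)}}>0,$$ $$z_b(x)=\frac{G(x)}{2g}-\int_0^1\frac{Q(\lambda)}{\sqrt{F(\lambda)-G(x)}}\,\mathrm{d}\lambda.$$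
   Context: $I=(0,1)$, $\bar I=[0,1]$, $g>0$ is the gravity constant. All functions are assumed regular enough for the equations to make sense classically ($H$, $\tilde u$, $z_b$, $\int_0^1H\,\mathrm{d}\lambda$ differentiable in $x$, $H$ integrable in $\lambda$). *)

theory Defs
  imports "HOL-Analysis.Analysis"
begin

text \<open>Fields are written \<open>H t x l\<close>, with time \<open>t\<close>, position \<open>x\<close> and vertical label
  \<open>l \<in> I\<close>; values at labels outside \<open>I\<close> are irrelevant to everything below.\<close>

abbreviation I :: "real set" where
  "I \<equiv> {0<..<1}"

definition height :: "(real \<Rightarrow> real \<Rightarrow> real \<Rightarrow> real) \<Rightarrow> real \<Rightarrow> real \<Rightarrow> real" where
  "height H t x = (LINT l:I|lebesgue. H t x l)"

text \<open>The standing regularity in \<open>x\<close> and \<open>l\<close>. Differentiability in \<open>t\<close> is part of being a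
  classical solution, see below.\<close>

definition regular ::
  "(real \<Rightarrow> real) \<Rightarrow> (real \<Rightarrow> real \<Rightarrow> real \<Rightarrow> real) \<Rightarrow> (real \<Rightarrow> real \<Rightarrow> real \<Rightarrow> real) \<Rightarrow> bool" where
  "regular z\<^sub>b H u \<longleftrightarrow>
     (\<forall>x. z\<^sub>b differentiable (at x)) \<and>
     (\<forall>t x. \<forall>l\<in>I. (\<lambda>y. H t y l) differentiable (at x)) \<and>
     (\<forall>t x. \<forall>l\<in>I. (\<lambda>y. u t y l) differentiable (at x)) \<and>
     (\<forall>t x. set_integrable lebesgue I (H t x)) \<and>
     (\<forall>t x. height H t differentiable (at x))"

text \<open>To be read together with \<^const>\<open>regular\<close>, which makes all the \<open>x\<close>-derivatives
  genuine.\<close>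

definition classical_solution ::
  "real \<Rightarrow> (real \<Rightarrow> real) \<Rightarrow> (real \<Rightarrow> real \<Rightarrow> real \<Rightarrow> real) \<Rightarrow> (real \<Rightarrow> real \<Rightarrow> real \<Rightarrow> real) \<Rightarrow> bool"
where
  "classical_solution g z\<^sub>b H u \<longleftrightarrow>
     (\<forall>t x. \<forall>l\<in>I.
        (\<lambda>s. H s x l) differentiable (at t) \<and>
        (\<lambda>s. u s x l) differentiable (at t) \<and>
        deriv (\<lambda>s. H s x l) t + deriv (\<lambda>y. H t y l * u t y l) x = 0 \<and>
        deriv (\<lambda>s. u s x l) t + u t x l * deriv (\<lambda>y. u t y l) x + g * deriv (height H t) x
          = - g * deriv z\<^sub>b x)"

definition time_independent :: "(real \<Rightarrow> real \<Rightarrow> real \<Rightarrow> real) \<Rightarrow> bool" where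
  "time_independent f \<longleftrightarrow> (\<forall>s t x. \<forall>l\<in>I. f s x l = f t x l)"

definition stationary_solution ::
  "real \<Rightarrow> (real \<Rightarrow> real) \<Rightarrow> (real \<Rightarrow> real \<Rightarrow> real \<Rightarrow> real) \<Rightarrow> (real \<Rightarrow> real \<Rightarrow> real \<Rightarrow> real) \<Rightarrow> bool"
where
  "stationary_solution g z\<^sub>b H u \<longleftrightarrow>
     classical_solution g z\<^sub>b H u \<and> time_independent H \<and> time_independent u"

end

theory Submission
  imports Defs
begin

text \<open>The momentum equation at a stationary solution is the \<open>x\<close>-derivative of the Bernoulli relation
  \<open>u\<^sup>2 + 2 g (z\<^sub>b + \<integral> H) = F(l)\<close>, and the mass equation that of \<open>H u = Q(l)\<close>. Setting
  \<open>G = 2 g (z\<^sub>b + \<integral> H)\<close>, these two first integrals are the representation of \<open>u\<close> and \<open>H\<close>,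
  and the definition of \<open>G\<close> is the formula for the topography.\<close>

lemma deriv_zero_imp_const:
  fixes f :: "real \<Rightarrow> real"
  assumes "\<And>x. (f has_real_derivative 0) (at x)"
  shows "f x = f y"
  using DERIV_isconst_all assms by blast

lemma regularD:
  assumes "regular z\<^sub>b H u"
  shows "(z\<^sub>b has_real_derivative deriv z\<^sub>b x) (at x)"
    and "(height H t has_real_derivative deriv (height H t) x) (at x)"
    and "l \<in> I \<Longrightarrow> ((\<lambda>y. H t y l) has_real_derivative deriv (\<lambda>y. H t y l) x) (at x)"
    and "l \<in> I \<Longrightarrow> ((\<lambda>y. u t y l) has_real_derivative deriv (\<lambda>y. u t y l) x) (at x)"
  using assms unfolding regular_def
  by (auto simp: DERIV_deriv_iff_real_differentiable)

text \<open>The bracket on the right is the steady momentum equation with all terms on one side; the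
  factor 2 comes from the square. So this equation holds exactly where the derivative
  vanishes.\<close>

lemma has_derivative_bernoulli:
  assumes "regular z\<^sub>b H u" and "l \<in> I"
  shows "((\<lambda>y. (u t y l)\<^sup>2 + 2 * g * (z\<^sub>b y + height H t y)) has_real_derivative
    2 * (u t x l * deriv (\<lambda>y. u t y l) x + g * deriv (height H t) x + g * deriv z\<^sub>b x)) (at x)"
  by (rule DERIV_cong[OF DERIV_add[OF DERIV_power[OF regularD(4)[OF assms]]
        DERIV_cmult[OF DERIV_add[OF regularD(1)[OF assms(1)] regularD(2)[OF assms(1)]]]]])
    (simp add: algebra_simps)

text \<open>A product of differentiable functions is differentiable, so \<open>deriv\<close> is a
  true derivative here and the steady mass equation does force the flux to be constant.\<close>

lemma has_derivative_flux:
  assumes "regular z\<^sub>b H u" and "l \<in> I"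
  shows "((\<lambda>y. H t y l * u t y l) has_real_derivative deriv (\<lambda>y. H t y l * u t y l) x) (at x)"
  unfolding DERIV_deriv_iff_real_differentiable
  by (intro differentiable_mult) (use assms in \<open>auto simp: regular_def\<close>)

text \<open>Without time derivatives, each equation says that an \<open>x\<close>-derivative
  vanishes on the whole line, which amounts to constancy in \<open>x\<close> for fixed
  \<open>t\<close> and \<open>l\<close>. What remains of the theorem is then algebra with two
  conserved quantities.\<close>

lemma stationary_solution_iff_first_integrals:
  assumes "regular z\<^sub>b H u"
  shows "stationary_solution g z\<^sub>b H u \<longleftrightarrow>
    time_independent H \<and> time_independent u \<and>
    (\<forall>t x y. \<forall>l\<in>I. H t x l * u t x l = H t y l * u t y l \<and>
      (u t x l)\<^sup>2 + 2 * g * (z\<^sub>b x + height H t x) = (u t y l)\<^sup>2 + 2 * g * (z\<^sub>b y + height H t y))"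
    (is "_ \<longleftrightarrow> _ \<and> _ \<and> ?integrals")
proof -
  \<comment> \<open>Serves both directions: it removes the time derivatives from the equations, and
    it supplies the differentiability in \<open>t\<close> that \<open>regular\<close> does not
    contain.\<close>
  have const_time: "((\<lambda>s. f s x l) has_real_derivative 0) (at t)"
    if "time_independent f" "l \<in> I" for f :: "real \<Rightarrow> real \<Rightarrow> real \<Rightarrow> real" and t x l
  proof -
    have "(\<lambda>s. f s x l) = (\<lambda>_. f t x l)"
      using that unfolding time_independent_def by blast
    then show ?thesis by simp
  qed
  have "classical_solution g z\<^sub>b H u \<longleftrightarrow> ?integrals"
    if steady: "time_independent H" "time_independent u"
  proof
    assume sol: "classical_solution g z\<^sub>b H u"
    have "((\<lambda>y. H t y l * u t y l) has_real_derivative 0) (at x)"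
      and "((\<lambda>y. (u t y l)\<^sup>2 + 2 * g * (z\<^sub>b y + height H t y)) has_real_derivative 0) (at x)"
      if l: "l \<in> I" for t x l
    proof -
      have eqs: "deriv (\<lambda>y. H t y l * u t y l) x = 0"
        "u t x l * deriv (\<lambda>y. u t y l) x + g * deriv (height H t) x + g * deriv z\<^sub>b x = 0"
        using sol[unfolded classical_solution_def, rule_format, OF l, of x t]
          const_time[OF steady(1) l, of x t, THEN DERIV_imp_deriv]
          const_time[OF steady(2) l, of x t, THEN DERIV_imp_deriv]
        by simp_all
      then show "((\<lambda>y. H t y l * u t y l) has_real_derivative 0) (at x)"
        using has_derivative_flux[OF assms l, of t x] by simp
      show "((\<lambda>y. (u t y l)\<^sup>2 + 2 * g * (z\<^sub>b y + height H t y)) has_real_derivative 0) (at x)"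
        using has_derivative_bernoulli[OF assms l, where t = t and x = x and g = g] eqs(2) by simp
    qed
    note D = this
    show ?integrals
      using deriv_zero_imp_const[OF D(1)] deriv_zero_imp_const[OF D(2)] by blast
  next
    assume int: ?integrals
    show "classical_solution g z\<^sub>b H u"
      unfolding classical_solution_def
    proof (intro allI ballI)
      fix t x l assume l: "l \<in> I"
      have "(\<lambda>y. H t y l * u t y l) = (\<lambda>_. H t 0 l * u t 0 l)"
        using int l by blast
      then have flux: "deriv (\<lambda>y. H t y l * u t y l) x = 0"
        by simp
      have "(\<lambda>y. (u t y l)\<^sup>2 + 2 * g * (z\<^sub>b y + height H t y)) =
          (\<lambda>_. (u t 0 l)\<^sup>2 + 2 * g * (z\<^sub>b 0 + height H t 0))"
        using int l by blast
      then have "((\<lambda>y. (u t y l)\<^sup>2 + 2 * g * (z\<^sub>b y + height H t y)) has_real_derivative 0) (at x)"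
        by simp
      \<comment> \<open>One and the same function has derivative 0, being constant, and twice the
        momentum expression; the two must agree.\<close>
      from DERIV_unique[OF this has_derivative_bernoulli[OF assms l]]
      have bernoulli: "u t x l * deriv (\<lambda>y. u t y l) x + g * deriv (height H t) x + g * deriv z\<^sub>b x = 0"
        by simp
      note T = const_time[OF steady(1) l, of x t] const_time[OF steady(2) l, of x t]
      show "(\<lambda>s. H s x l) differentiable (at t) \<and> (\<lambda>s. u s x l) differentiable (at t) \<and>
        deriv (\<lambda>s. H s x l) t + deriv (\<lambda>y. H t y l * u t y l) x = 0 \<and>
        deriv (\<lambda>s. u s x l) t + u t x l * deriv (\<lambda>y. u t y l) x + g * deriv (height H t) x
          = - g * deriv z\<^sub>b x"
        using T[THEN DERIV_imp_deriv] T flux bernoulli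
        by (auto simp: real_differentiable_def)
    qed
  qed
  then show ?thesis
    unfolding stationary_solution_def by blast
qed

theorem proposition3p1:
  fixes g :: real and z\<^sub>b :: "real \<Rightarrow> real"
    and H u :: "real \<Rightarrow> real \<Rightarrow> real \<Rightarrow> real"
  assumes "g > 0" and "regular z\<^sub>b H u"
  shows "(stationary_solution g z\<^sub>b H u \<and> (\<forall>t x. \<forall>l\<in>I. H t x l > 0 \<and> u t x l > 0)) \<longleftrightarrow>
    (\<exists>F G Q :: real \<Rightarrow> real.
       (\<forall>x. \<forall>l\<in>I. F l - G x > 0) \<and>
       (\<forall>t x. \<forall>l\<in>I. u t x l = sqrt (F l - G x) \<and> sqrt (F l - G x) > 0) \<and>
       (\<forall>t x. \<forall>l\<in>I. H t x l = Q l / sqrt (F l - G x) \<and> Q l / sqrt (F l - G x) > 0) \<and>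
       (\<forall>x. z\<^sub>b x = G x / (2 * g) - (LINT l:I|lebesgue. Q l / sqrt (F l - G x))))"
    (is "?L \<longleftrightarrow> (\<exists>F G Q. ?R F G Q)")
proof
  assume L: ?L
  then have steady: "time_independent H" "time_independent u"
    and flux: "\<And>t x y l. l \<in> I \<Longrightarrow> H t x l * u t x l = H t y l * u t y l"
    and bernoulli: "\<And>t x y l. l \<in> I \<Longrightarrow> (u t x l)\<^sup>2 + 2 * g * (z\<^sub>b x + height H t x)
      = (u t y l)\<^sup>2 + 2 * g * (z\<^sub>b y + height H t y)"
    and pos: "\<And>t x l. l \<in> I \<Longrightarrow> H t x l > 0" "\<And>t x l. l \<in> I \<Longrightarrow> u t x l > 0"
    unfolding stationary_solution_iff_first_integrals[OF assms(2)] by blast+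
  \<comment> \<open>By steadiness, time 0 represents all times. \<open>F\<close> is the Bernoulli
    constant of label \<open>l\<close>, and \<open>Q\<close> its flux, both evaluated at
    \<open>x = 0\<close>.\<close>
  define G where "G x = 2 * g * (z\<^sub>b x + height H 0 x)" for x
  define F where "F l = (u 0 0 l)\<^sup>2 + G 0" for l
  define Q where "Q l = H 0 0 l * u 0 0 l" for l
  have sq: "F l - G x = (u 0 x l)\<^sup>2" if "l \<in> I" for x l
    using bernoulli[OF that, of 0 x 0] by (simp add: F_def G_def)
  \<comment> \<open>Positivity of \<open>u\<close> selects the positive root, and steadiness carries
    it from time 0 to \<open>t\<close>.\<close>
  have u: "sqrt (F l - G x) = u t x l" if "l \<in> I" for t x l
    using sq[OF that, of x] pos(2)[OF that, of 0 x] that steady(2)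
    unfolding time_independent_def by (metis less_imp_le real_sqrt_unique)
  have H: "H t x l = Q l / sqrt (F l - G x)" if "l \<in> I" for t x l
  proof -
    have "Q l = H 0 x l * u 0 x l"
      unfolding Q_def by (rule flux[OF that])
    moreover have "H t x l = H 0 x l"
      using steady(1) that unfolding time_independent_def by blast
    ultimately show ?thesis
      using pos(2)[OF that, of 0 x] by (simp add: u[OF that, of x 0])
  qed
  have "height H 0 x = (LINT l:I|lebesgue. Q l / sqrt (F l - G x))" for x
    unfolding height_def by (rule set_lebesgue_integral_cong) (use H in auto)
  \<comment> \<open>The definition of \<open>G\<close> is solved for the topography, dividing by
    \<open>2 * g > 0\<close>.\<close>
  then have "z\<^sub>b x = G x / (2 * g) - (LINT l:I|lebesgue. Q l / sqrt (F l - G x))" for x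
    using assms(1) by (simp add: G_def field_simps)
  moreover have "F l - G x > 0" if "l \<in> I" for x l
    using sq[OF that] pos(2)[OF that, of 0 x] by simp
  ultimately have "?R F G Q"
    using u H pos by (simp flip: H)
  then show "\<exists>F G Q. ?R F G Q" by blast
next
  assume "\<exists>F G Q. ?R F G Q"
  then obtain F G Q where R: "?R F G Q" by blast
  then have gap: "\<And>x l. l \<in> I \<Longrightarrow> F l - G x > 0"
    and u: "\<And>t x l. l \<in> I \<Longrightarrow> u t x l = sqrt (F l - G x)"
    and H: "\<And>t x l. l \<in> I \<Longrightarrow> H t x l = Q l / sqrt (F l - G x)"
    and z\<^sub>b: "\<And>x. z\<^sub>b x = G x / (2 * g) - (LINT l:I|lebesgue. Q l / sqrt (F l - G x))"
    by blast+
  have "height H t x = (LINT l:I|lebesgue. Q l / sqrt (F l - G x))" for t x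
    unfolding height_def by (rule set_lebesgue_integral_cong) (use H in auto)
  \<comment> \<open>The integral subtracted in the topography formula is the height, so adding the
    height leaves \<open>G x / (2 * g)\<close>.\<close>
  then have "2 * g * (z\<^sub>b x + height H t x) = G x" for t x
    using assms(1) by (simp add: z\<^sub>b)
  \<comment> \<open>Since the gap is positive, \<open>u\<close> squares to \<open>F l - G x\<close>;
    \<open>G x\<close> cancels and only the label remains.\<close>
  then have "(u t x l)\<^sup>2 + 2 * g * (z\<^sub>b x + height H t x) = F l" if "l \<in> I" for t x l
    using gap[OF that, of x] by (simp add: u[OF that])
  moreover have "H t x l * u t x l = Q l" if "l \<in> I" for t x l
    using gap[OF that, of x] by (simp add: u[OF that] H[OF that])
  \<comment> \<open>The representation formulas do not contain \<open>t\<close>.\<close>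
  moreover have "time_independent H" "time_independent u"
    unfolding time_independent_def by (simp_all add: u H)
  ultimately have "stationary_solution g z\<^sub>b H u"
    unfolding stationary_solution_iff_first_integrals[OF assms(2)] by simp
  moreover have "H t x l > 0 \<and> u t x l > 0" if "l \<in> I" for t x l
    using R that by simp
  ultimately show ?L by blast
qed

end
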